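(* Let $F(t,s)=\sum_{r=s+1}^{t}|\xi(t,r)|$ for $t>s$, and let $\mathbb{MSE}_{t,s}=\sum_{r=s+1}^{t}\xi_q^2(t,r)\sigma^2(r)$ be the mean square forecasting error of a TV-ARMA($p,q$) model with deterministic coefficients. If $\{F(t,s)\}_t$ is bounded, as a function of $t$, for each fixed $s$, then the mean square error $\mathbb{MSE}_{t,s}$ is also bounded, as a function of $t$. Equivalently, the boundedness of $\{F(t,s)\}_t$ entails that for each $s$ either $\lim_{t\to\infty}\mathbb{MSE}_{t,s}$ exists in $\mathbb{R}_{\ge 0}$ or $\{\mathbb{MSE}_{t,s}\}_t$ oscillates with oscillation $$\Omega(s)=\inf_t\Big(\sup_{r\ge t}\mathbb{MSE}_{r,s}-\inf_{r\ge t}\mathbb{MSE}_{r,s}\Big).$$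
   Context: Consider the TV-ARMA($p,q$) equation ($p,q\ge1$) with deterministic coefficients $y_t=\varphi(t)+\sum_{m=1}^{p}\phi_m(t)y_{t-m}+\varepsilon_t+\sum_{l=1}^{q}\theta_l(t)\varepsilon_{t-l}$, $t\in\mathbb{Z}$, where $\mathbb{E}(\varepsilon_t)=0$, $\mathbb{E}(\varepsilon_t\varepsilon_s)=0$ for $s\ne t$, $\mathbb{E}(\varepsilon_t\mid y_s,s<t)=0$, $\mathbb{E}(\varepsilon_t^2)=\sigma^2(t)$, $0<\sigma^2(t)\le M<\infty$. Standing assumptions of the forecasting setting: $\sum_{r=-\infty}^{t}|\xi(t,r)|<\infty$ for all $t$, and $\varphi(t)$, $\theta_l(t)$ ($1\le l\le q$) are bounded in $t$. For integers $s<t$, $\xi(t,s)=\det(\mathbf{\Phi}_{t,s})$, where $\mathbf{\Phi}_{t,s}$ is the $(t-s)\times(t-s)$ matrix whose $(i,j)$ entry is $\phi_{i-j+1}(s+i)$ if $0\le i-j\le p-1$, $-1$ if $j=i+1$, and $0$ otherwise; $\xi(t,t)=1$ and $\xi(t,s)=0$ for $t<s$. Also $\xi_q(t,r)=\xi(t,r)+\sum_{l=1}^{q}\xi(t,r+l)\theta_l(r+l)$. $\mathbb{MSE}_{t,s}$ is the variance of the forecast error $\sum_{r=s+1}^{t}\xi_q(t,r)\varepsilon_r$ of the optimal linear predictor of $y_t$ at time $s<t$. *)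

theory Defs
  imports
    "HOL-Probability.Probability"
    "Jordan_Normal_Form.Determinant"
begin

text \<open>
  Coefficient families are indexed as \<open>\<phi> m t\<close> for $\phi_m(t)$ and \<open>\<theta> l t\<close> for $\theta_l(t)$;
  only the indices \<open>1..p\<close> and \<open>1..q\<close> matter. The drift is \<open>\<phi>0\<close>, and \<open>\<sigma>2 t\<close> stands for $\sigma^2(t)$.
\<close>

definition past_sigma :: "'a measure \<Rightarrow> (int \<Rightarrow> 'a \<Rightarrow> real) \<Rightarrow> int \<Rightarrow> 'a measure" where
  "past_sigma M y t =
     sigma (space M) (\<Union>s\<in>{..<t}. {y s -` A \<inter> space M | A. A \<in> sets borel})"

locale tv_arma = prob_space M
  for M :: "'a measure" +
  fixes p q :: nat
    and \<phi>0 :: "int \<Rightarrow> real"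
    and \<phi> \<theta> :: "nat \<Rightarrow> int \<Rightarrow> real"
    and \<sigma>2 :: "int \<Rightarrow> real"
    and y \<epsilon> :: "int \<Rightarrow> 'a \<Rightarrow> real"
  assumes p_ge_1: "p \<ge> 1"
    and q_ge_1: "q \<ge> 1"
    and y_rv: "\<And>t. random_variable borel (y t)"
    and eps_rv: "\<And>t. random_variable borel (\<epsilon> t)"
    and equation: "\<And>t. AE \<omega> in M.
          y t \<omega> = \<phi>0 t + (\<Sum>m=1..p. \<phi> m t * y (t - int m) \<omega>)
                + \<epsilon> t \<omega> + (\<Sum>l=1..q. \<theta> l t * \<epsilon> (t - int l) \<omega>)"
    and eps_square_integrable: "\<And>t. integrable M (\<lambda>\<omega>. (\<epsilon> t \<omega>)\<^sup>2)"
    and eps_mean: "\<And>t. expectation (\<epsilon> t) = 0"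
    and eps_uncorrelated: "\<And>t s. s \<noteq> t \<Longrightarrow> expectation (\<lambda>\<omega>. \<epsilon> t \<omega> * \<epsilon> s \<omega>) = 0"
    and eps_mds: "\<And>t. AE \<omega> in M. real_cond_exp M (past_sigma M y t) (\<epsilon> t) \<omega> = 0"
    and eps_variance: "\<And>t. expectation (\<lambda>\<omega>. (\<epsilon> t \<omega>)\<^sup>2) = \<sigma>2 t"
    and variance_pos: "\<And>t. 0 < \<sigma>2 t"
    and variance_bounded: "\<exists>K. \<forall>t. \<sigma>2 t \<le> K"

text \<open>Row and column indices start at 0 here, hence the shift \<open>s + int i + 1\<close> in the time argument.\<close>

definition Phi_mat :: "nat \<Rightarrow> (nat \<Rightarrow> int \<Rightarrow> real) \<Rightarrow> int \<Rightarrow> int \<Rightarrow> real Matrix.mat" where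
  "Phi_mat p \<phi> t s = Matrix.mat (nat (t - s)) (nat (t - s))
     (\<lambda>(i, j). if j \<le> i \<and> i - j \<le> p - 1 then \<phi> (i - j + 1) (s + int i + 1)
               else if j = i + 1 then -1
               else 0)"

definition xi :: "nat \<Rightarrow> (nat \<Rightarrow> int \<Rightarrow> real) \<Rightarrow> int \<Rightarrow> int \<Rightarrow> real" where
  "xi p \<phi> t s =
     (if s < t then Determinant.det (Phi_mat p \<phi> t s) else if s = t then 1 else 0)"

definition xi_q ::
  "nat \<Rightarrow> nat \<Rightarrow> (nat \<Rightarrow> int \<Rightarrow> real) \<Rightarrow> (nat \<Rightarrow> int \<Rightarrow> real) \<Rightarrow> int \<Rightarrow> int \<Rightarrow> real" where
  "xi_q p q \<phi> \<theta> t r =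
     xi p \<phi> t r + (\<Sum>l=1..q. xi p \<phi> t (r + int l) * \<theta> l (r + int l))"

definition forecast_error ::
  "nat \<Rightarrow> nat \<Rightarrow> (nat \<Rightarrow> int \<Rightarrow> real) \<Rightarrow> (nat \<Rightarrow> int \<Rightarrow> real) \<Rightarrow> (int \<Rightarrow> 'a \<Rightarrow> real)
     \<Rightarrow> int \<Rightarrow> int \<Rightarrow> 'a \<Rightarrow> real" where
  "forecast_error p q \<phi> \<theta> \<epsilon> t s \<omega> = (\<Sum>r=s+1..t. xi_q p q \<phi> \<theta> t r * \<epsilon> r \<omega>)"

definition MSE ::
  "'a measure \<Rightarrow> nat \<Rightarrow> nat \<Rightarrow> (nat \<Rightarrow> int \<Rightarrow> real) \<Rightarrow> (nat \<Rightarrow> int \<Rightarrow> real)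
     \<Rightarrow> (int \<Rightarrow> 'a \<Rightarrow> real) \<Rightarrow> int \<Rightarrow> int \<Rightarrow> real" where
  "MSE M p q \<phi> \<theta> \<epsilon> t s = prob_space.variance M (forecast_error p q \<phi> \<theta> \<epsilon> t s)"

definition F_sum :: "nat \<Rightarrow> (nat \<Rightarrow> int \<Rightarrow> real) \<Rightarrow> int \<Rightarrow> int \<Rightarrow> real" where
  "F_sum p \<phi> t s = (\<Sum>r=s+1..t. \<bar>xi p \<phi> t r\<bar>)"

text \<open>
  Sequences below are indexed by the integers \<open>t > s\<close>. Suprema and infima are taken in the
  extended reals, so that the oscillation of an unbounded sequence is not an arbitrary real.
\<close>

definition oscillation :: "(int \<Rightarrow> real) \<Rightarrow> int \<Rightarrow> ereal" where
  "oscillation f s =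
     (INF t\<in>{s<..}. (SUP r\<in>{t..}. ereal (f r)) - (INF r\<in>{t..}. ereal (f r)))"

text \<open>A sequence oscillates if it has no limit, finite or infinite.\<close>

definition oscillates :: "(int \<Rightarrow> real) \<Rightarrow> bool" where
  "oscillates f \<longleftrightarrow> \<not> (\<exists>L :: ereal. ((\<lambda>t. ereal (f t)) \<longlongrightarrow> L) at_top)"

end

theory Submission
  imports Defs
begin

text \<open>
  The innovations are uncorrelated, so the MSE is a sum of squares, and a sum of squares is at most
  the square of the sum of absolute values. As \<open>xi\<close> vanishes for \<open>t < r\<close>, shifting the second
  argument of \<open>xi\<close> forwards only loses terms of \<open>F_sum\<close>; this bounds
  $\sum_r |\xi_q(t,r)|$ by a constant multiple of $F(t,s)$. For a nonnegative sequence, an infinite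
  oscillation means unboundedness and a zero oscillation is the Cauchy criterion.
\<close>

section \<open>Orthogonal innovations and the MSE as a sum of squares\<close>

lemma (in prob_space) variance_uncorrelated_sum:
  fixes X :: "'i \<Rightarrow> 'a \<Rightarrow> real"
  assumes "finite I"
    and rv: "\<And>i. i \<in> I \<Longrightarrow> random_variable borel (X i)"
    and sq: "\<And>i. i \<in> I \<Longrightarrow> integrable M (\<lambda>\<omega>. (X i \<omega>)\<^sup>2)"
    and mean: "\<And>i. i \<in> I \<Longrightarrow> expectation (X i) = 0"
    and uncor: "\<And>i j. i \<in> I \<Longrightarrow> j \<in> I \<Longrightarrow> i \<noteq> j \<Longrightarrow> expectation (\<lambda>\<omega>. X i \<omega> * X j \<omega>) = 0"
  shows "variance (\<lambda>\<omega>. \<Sum>i\<in>I. c i * X i \<omega>) = (\<Sum>i\<in>I. (c i)\<^sup>2 * expectation (\<lambda>\<omega>. (X i \<omega>)\<^sup>2))"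
proof -
  have int1: "integrable M (X i)" if "i \<in> I" for i
    using square_integrable_imp_integrable rv sq that by blast
  have int2: "integrable M (\<lambda>\<omega>. X i \<omega> * X j \<omega>)" if "i \<in> I" "j \<in> I" for i j
  proof (rule Bochner_Integration.integrable_bound)
    show "integrable M (\<lambda>\<omega>. (X i \<omega>)\<^sup>2 + (X j \<omega>)\<^sup>2)"
      using sq that by auto
    show "(\<lambda>\<omega>. X i \<omega> * X j \<omega>) \<in> borel_measurable M"
      using rv that by measurable
    \<comment> \<open>Square integrability passes to products:
      \<open>2 * \<bar>a\<bar> * \<bar>b\<bar>\<close> is at most the sum of squares, and
      nonnegativity allows the factor 2 to be dropped.\<close>
    have "\<bar>a * b\<bar> \<le> a\<^sup>2 + b\<^sup>2" for a b :: real
      using sum_squares_bound[of "\<bar>a\<bar>" "\<bar>b\<bar>"] abs_ge_zero[of "a * b"]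
      unfolding abs_mult power2_abs by linarith
    then show "AE \<omega> in M. norm (X i \<omega> * X j \<omega>) \<le> norm ((X i \<omega>)\<^sup>2 + (X j \<omega>)\<^sup>2)"
      by simp
  qed
  have "expectation (\<lambda>\<omega>. \<Sum>i\<in>I. c i * X i \<omega>) = 0"
    using int1 mean by simp
  then have "variance (\<lambda>\<omega>. \<Sum>i\<in>I. c i * X i \<omega>)
      = expectation (\<lambda>\<omega>. \<Sum>i\<in>I. \<Sum>j\<in>I. (c i * c j) * (X i \<omega> * X j \<omega>))"
    by (simp add: power2_eq_square sum_product mult_ac)
  also have "\<dots> = (\<Sum>i\<in>I. \<Sum>j\<in>I. (c i * c j) * expectation (\<lambda>\<omega>. X i \<omega> * X j \<omega>))"
    using int2 by simp
  also have "\<dots> = (\<Sum>i\<in>I. \<Sum>j\<in>I. if j = i then (c i)\<^sup>2 * expectation (\<lambda>\<omega>. (X i \<omega>)\<^sup>2) else 0)"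
    using uncor by (intro sum.cong refl) (auto simp: power2_eq_square)
  also have "\<dots> = (\<Sum>i\<in>I. (c i)\<^sup>2 * expectation (\<lambda>\<omega>. (X i \<omega>)\<^sup>2))"
    using \<open>finite I\<close> by simp
  finally show ?thesis .
qed

text \<open>The weights are deterministic, so orthogonality of the innovations removes all cross
  terms. For \<open>t \<le> s\<close> both sides are 0.\<close>

lemma (in tv_arma) MSE_eq:
  "MSE M p q \<phi> \<theta> \<epsilon> t s = (\<Sum>r=s+1..t. (xi_q p q \<phi> \<theta> t r)\<^sup>2 * \<sigma>2 r)"
proof -
  have "variance (\<lambda>\<omega>. \<Sum>r=s+1..t. xi_q p q \<phi> \<theta> t r * \<epsilon> r \<omega>)
      = (\<Sum>r=s+1..t. (xi_q p q \<phi> \<theta> t r)\<^sup>2 * expectation (\<lambda>\<omega>. (\<epsilon> r \<omega>)\<^sup>2))"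
    by (rule variance_uncorrelated_sum)
      (use eps_rv eps_square_integrable eps_mean eps_uncorrelated in auto)
  then show ?thesis
    unfolding MSE_def forecast_error_def[abs_def] eps_variance .
qed

section \<open>Absolute-sum bounds and boundedness of the MSE\<close>

lemma sum_abs_xi_shift_le:
  "(\<Sum>r=s+1..t. \<bar>xi p \<phi> t (r + int l)\<bar>) \<le> F_sum p \<phi> t s"
proof -
  have "(\<Sum>r=s+1..t. \<bar>xi p \<phi> t (r + int l)\<bar>) = (\<Sum>r\<in>(\<lambda>r. r + int l) ` {s+1..t}. \<bar>xi p \<phi> t r\<bar>)"
    by (subst sum.reindex) (simp_all add: inj_on_def)
  \<comment> \<open>The shifted indices that leave \<open>{s+1..t}\<close> all exceed
    \<open>t\<close>, where \<open>xi\<close> is 0.\<close>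
  also have "\<dots> = (\<Sum>r\<in>(\<lambda>r. r + int l) ` {s+1..t} \<inter> {s+1..t}. \<bar>xi p \<phi> t r\<bar>)"
    by (rule sum.mono_neutral_right) (auto simp: xi_def)
  also have "\<dots> \<le> F_sum p \<phi> t s"
    unfolding F_sum_def by (rule sum_mono2) auto
  finally show ?thesis .
qed

text \<open>The leading term of \<open>xi_q\<close> contributes one copy of \<open>F_sum\<close>,
  and each of the \<open>q\<close> lags contributes at most \<open>B\<close> copies.\<close>

lemma sum_abs_xi_q_le:
  assumes "\<And>l r. l \<in> {1..q} \<Longrightarrow> \<bar>\<theta> l r\<bar> \<le> B"
  shows "(\<Sum>r=s+1..t. \<bar>xi_q p q \<phi> \<theta> t r\<bar>) \<le> (1 + real q * B) * F_sum p \<phi> t s"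
proof (cases "q = 0")
  \<comment> \<open>For \<open>q = 0\<close> the assumption is vacuous and \<open>B\<close> may be
    negative; the factor is then 1. Otherwise lag 1 forces \<open>0 \<le> B\<close>.\<close>
  case True
  then show ?thesis
    by (simp add: xi_q_def F_sum_def)
next
  case False
  then have "0 \<le> B"
    using assms[of 1 0] by force
  have "\<bar>xi_q p q \<phi> \<theta> t r\<bar> \<le> \<bar>xi p \<phi> t r\<bar> + (\<Sum>l=1..q. \<bar>xi p \<phi> t (r + int l)\<bar> * B)" for r
  proof -
    have "\<bar>\<Sum>l=1..q. xi p \<phi> t (r + int l) * \<theta> l (r + int l)\<bar> \<le> (\<Sum>l=1..q. \<bar>xi p \<phi> t (r + int l)\<bar> * B)"
      by (rule order_trans[OF sum_abs sum_mono]) (use assms in \<open>auto simp: abs_mult intro: mult_left_mono\<close>)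
    then show ?thesis
      unfolding xi_q_def by linarith
  qed
  then have "(\<Sum>r=s+1..t. \<bar>xi_q p q \<phi> \<theta> t r\<bar>)
      \<le> (\<Sum>r=s+1..t. \<bar>xi p \<phi> t r\<bar> + (\<Sum>l=1..q. \<bar>xi p \<phi> t (r + int l)\<bar> * B))"
    by (rule sum_mono)
  also have "\<dots> = F_sum p \<phi> t s + (\<Sum>l=1..q. (\<Sum>r=s+1..t. \<bar>xi p \<phi> t (r + int l)\<bar>) * B)"
    \<comment> \<open>Swapping the sums over \<open>r\<close> and \<open>l\<close> isolates one
      shifted sum per lag.\<close>
    unfolding sum.distrib F_sum_def sum_distrib_right by (subst (2) sum.swap) simp
  also have "\<dots> \<le> F_sum p \<phi> t s + (\<Sum>l=1..q. F_sum p \<phi> t s * B)"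
    using \<open>0 \<le> B\<close> by (intro add_left_mono sum_mono mult_right_mono sum_abs_xi_shift_le)
  finally show ?thesis
    by (simp add: algebra_simps)
qed

lemma (in tv_arma) MSE_bounded:
  assumes \<theta>: "\<And>l. l \<in> {1..q} \<Longrightarrow> bounded (range (\<theta> l))"
    and F: "bounded ((\<lambda>t. F_sum p \<phi> t s) ` A)"
  shows "bounded ((\<lambda>t. MSE M p q \<phi> \<theta> \<epsilon> t s) ` A)"
proof -
  \<comment> \<open>There are finitely many lags, so one \<open>B\<close> serves all lags and all
    times.\<close>
  have "bounded (\<Union>l\<in>{1..q}. range (\<theta> l))"
    using \<theta> by auto
  then obtain B where B: "\<And>l r. l \<in> {1..q} \<Longrightarrow> \<bar>\<theta> l r\<bar> \<le> B"
    unfolding bounded_iff by fastforce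
  obtain C where C: "\<And>t. t \<in> A \<Longrightarrow> \<bar>F_sum p \<phi> t s\<bar> \<le> C"
    using F unfolding bounded_iff by auto
  obtain K where K: "\<And>t. \<sigma>2 t \<le> K"
    using variance_bounded by blast
  have "0 \<le> K"
    using K[of 0] variance_pos[of 0] by linarith
  have "0 \<le> B"
    using B[of 1 0] q_ge_1 by force
  have "\<bar>MSE M p q \<phi> \<theta> \<epsilon> t s\<bar> \<le> ((1 + real q * B) * C)\<^sup>2 * K" if "t \<in> A" for t
  proof -
    let ?a = "\<lambda>r. \<bar>xi_q p q \<phi> \<theta> t r\<bar>"
    have "MSE M p q \<phi> \<theta> \<epsilon> t s \<le> (\<Sum>r=s+1..t. (?a r)\<^sup>2 * K)"
      unfolding MSE_eq using K by (intro sum_mono) (simp add: mult_left_mono)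
    also have "\<dots> = (\<Sum>r=s+1..t. ?a r * ?a r) * K"
      by (simp add: sum_distrib_right power2_eq_square)
    \<comment> \<open>One factor of each square is enlarged to the whole sum, which dominates each
      of its nonnegative terms.\<close>
    also have "(\<Sum>r=s+1..t. ?a r * ?a r) \<le> (\<Sum>r=s+1..t. ?a r * (\<Sum>r=s+1..t. ?a r))"
      by (intro sum_mono mult_left_mono member_le_sum) auto
    also have "\<dots> = (\<Sum>r=s+1..t. ?a r)\<^sup>2"
      by (simp add: sum_distrib_right power2_eq_square)
    also have "\<dots> \<le> ((1 + real q * B) * C)\<^sup>2"
    proof (rule power_mono)
      have "(\<Sum>r=s+1..t. ?a r) \<le> (1 + real q * B) * F_sum p \<phi> t s"
        using B by (rule sum_abs_xi_q_le)
      also have "\<dots> \<le> (1 + real q * B) * C"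
        using C[OF that] \<open>0 \<le> B\<close> by (intro mult_left_mono) auto
      finally show "(\<Sum>r=s+1..t. ?a r) \<le> (1 + real q * B) * C" .
    qed (simp add: sum_nonneg)
    finally have "MSE M p q \<phi> \<theta> \<epsilon> t s \<le> ((1 + real q * B) * C)\<^sup>2 * K"
      using \<open>0 \<le> K\<close> by (simp add: mult_right_mono)
    moreover have "0 \<le> MSE M p q \<phi> \<theta> \<epsilon> t s"
      unfolding MSE_eq using variance_pos by (intro sum_nonneg) (simp add: less_imp_le)
    ultimately show ?thesis
      by simp
  qed
  then show ?thesis
    unfolding bounded_iff by auto
qed

section \<open>Limits of integer-indexed sequences\<close>

text \<open>Only finitely many integers lie between \<open>s\<close> and the time after which
  \<open>f\<close> stays within distance 1 of \<open>L\<close>.\<close>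

lemma int_tendsto_bounded:
  fixes f :: "int \<Rightarrow> 'b::metric_space"
  assumes "(f \<longlongrightarrow> L) at_top"
  shows "bounded (f ` {s<..})"
proof -
  have "eventually (\<lambda>t. dist (f t) L < 1) at_top"
    using assms by (rule tendstoD) simp
  then obtain N where N: "\<And>t. t \<ge> N \<Longrightarrow> dist (f t) L < 1"
    by (auto simp: eventually_at_top_linorder)
  have "f t \<in> f ` {s<..N} \<union> ball L 1" if "s < t" for t
    using N[of t] that by (cases "t \<le> N") (auto simp: dist_commute)
  then have "f ` {s<..} \<subseteq> f ` {s<..N} \<union> ball L 1"
    by blast
  moreover have "bounded (f ` {s<..N} \<union> ball L 1)"
    by (simp add: finite_imp_bounded)
  ultimately show ?thesis
    by (rule bounded_subset[rotated])
qed

text \<open>Completeness is applied to the subsequence at the nonnegative integers; the Cauchy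
  condition then carries its limit over to \<open>at_top\<close> on the integers.\<close>

lemma int_Cauchy_tendsto:
  fixes f :: "int \<Rightarrow> 'b::complete_space"
  assumes C: "\<And>e. e > 0 \<Longrightarrow> \<exists>t. \<forall>u\<ge>t. \<forall>v\<ge>t. dist (f u) (f v) < e"
  shows "\<exists>L. (f \<longlongrightarrow> L) at_top"
proof -
  have "Cauchy (\<lambda>n. f (int n))"
  proof (rule metric_CauchyI)
    fix e :: real assume "e > 0"
    then obtain t where t: "\<forall>u\<ge>t. \<forall>v\<ge>t. dist (f u) (f v) < e"
      using C by blast
    then have "\<forall>m\<ge>nat t. \<forall>n\<ge>nat t. dist (f (int m)) (f (int n)) < e"
      by (simp add: nat_le_iff)
    then show "\<exists>N. \<forall>m\<ge>N. \<forall>n\<ge>N. dist (f (int m)) (f (int n)) < e" ..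
  qed
  then obtain L where L: "(\<lambda>n. f (int n)) \<longlonglongrightarrow> L"
    using Cauchy_convergent convergentD by blast
  have "(f \<longlongrightarrow> L) at_top"
  proof (rule tendstoI)
    fix e :: real assume "e > 0"
    then obtain t where t: "\<forall>u\<ge>t. \<forall>v\<ge>t. dist (f u) (f v) < e / 2"
      using C[of "e / 2"] by auto
    have "eventually (\<lambda>n. dist (f (int n)) L < e / 2) sequentially"
      using L by (rule tendstoD) (use \<open>e > 0\<close> in simp)
    then obtain N where "\<And>n. n \<ge> N \<Longrightarrow> dist (f (int n)) L < e / 2"
      by (auto simp: eventually_sequentially)
    \<comment> \<open>This \<open>n\<close> is late enough for both estimates, so
      \<open>f (int n)\<close> links \<open>f u\<close> to \<open>L\<close>.\<close>
    then obtain n where n: "dist (f (int n)) L < e / 2" "n \<ge> nat t"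
      using max.cobounded1 max.cobounded2 by blast
    have "dist (f u) L < e" if "u \<ge> t" for u
    proof -
      have "dist (f u) (f (int n)) < e / 2"
        using t n(2) that by (simp add: nat_le_iff)
      with n(1) show ?thesis
        using dist_triangle[of "f u" L "f (int n)"] by linarith
    qed
    then show "eventually (\<lambda>u. dist (f u) L < e) at_top"
      by (auto simp: eventually_at_top_linorder)
  qed
  then show ?thesis ..
qed

section \<open>Oscillation, boundedness and convergence\<close>

text \<open>A finite supremum over one tail, together with the lower bound \<open>m\<close> and the
  finitely many earlier values after \<open>s\<close>, would bound \<open>f\<close> on
  \<open>{s<..}\<close>. Hence every tail has infinite supremum.\<close>

lemma oscillation_eq_PInf:
  fixes f :: "int \<Rightarrow> real"
  assumes lower: "\<And>t. m \<le> f t" and unb: "\<not> bounded (f ` {s<..})"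
  shows "oscillation f s = \<infinity>"
proof -
  have "(SUP r\<in>{t..}. ereal (f r)) - (INF r\<in>{t..}. ereal (f r)) = \<infinity>" if "s < t" for t
  proof -
    have "(SUP r\<in>{t..}. ereal (f r)) = \<infinity>"
    proof (rule ccontr)
      assume "(SUP r\<in>{t..}. ereal (f r)) \<noteq> \<infinity>"
      moreover have "ereal m \<le> (SUP r\<in>{t..}. ereal (f r))"
        using lower by (intro SUP_upper2[of t]) auto
      ultimately obtain b where b: "(SUP r\<in>{t..}. ereal (f r)) = ereal b"
        by (cases "SUP r\<in>{t..}. ereal (f r)") auto
      have "f r \<le> b" if "r \<ge> t" for r
        using SUP_upper[of r "{t..}" "\<lambda>r. ereal (f r)"] b that by simp
      then have "f r \<in> f ` {s<..t} \<union> {m..b}" if "s < r" for r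
        using lower that by (cases "r \<le> t") auto
      then have "f ` {s<..} \<subseteq> f ` {s<..t} \<union> {m..b}"
        by blast
      moreover have "bounded (f ` {s<..t} \<union> {m..b})"
        by (simp add: finite_imp_bounded)
      ultimately show False
        using unb bounded_subset by blast
    qed
    \<comment> \<open>This keeps the difference from being infinity minus infinity.\<close>
    moreover have "(INF r\<in>{t..}. ereal (f r)) \<le> ereal (f t)"
      by (rule INF_lower) simp
    ultimately show ?thesis
      by (cases "INF r\<in>{t..}. ereal (f r)") auto
  qed
  then show ?thesis
    unfolding oscillation_def by (simp add: top_ereal_def[symmetric])
qed

lemma oscillation_bounded:
  fixes f :: "int \<Rightarrow> real"
  assumes "bounded (f ` {s<..})"
  obtains \<Omega> where "\<Omega> \<ge> 0" "oscillation f s = ereal \<Omega>"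
proof -
  obtain b where b: "\<And>t. s < t \<Longrightarrow> \<bar>f t\<bar> \<le> b"
    using assms unfolding bounded_iff by auto
  have "0 \<le> oscillation f s"
    unfolding oscillation_def
  proof (rule INF_greatest)
    fix t assume "t \<in> {s<..}"
    have "(INF r\<in>{t..}. ereal (f r)) \<le> (SUP r\<in>{t..}. ereal (f r))"
      by (rule INF_le_SUP) simp
    then show "0 \<le> (SUP r\<in>{t..}. ereal (f r)) - (INF r\<in>{t..}. ereal (f r))"
      by (rule ereal_diff_positive)
  qed
  moreover have "oscillation f s \<le> ereal b - ereal (- b)"
    unfolding oscillation_def
  proof (rule INF_lower2)
    \<comment> \<open>The tail from \<open>s + 1\<close> is the whole sequence after
      \<open>s\<close>, so the bound on all its values gives at most \<open>2 * b\<close>.\<close>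
    show "s + 1 \<in> {s<..}" by simp
    have "f r \<le> b" "- b \<le> f r" if "r \<in> {s+1..}" for r
      using b[of r] that by (auto simp: abs_le_iff)
    then show "(SUP r\<in>{s+1..}. ereal (f r)) - (INF r\<in>{s+1..}. ereal (f r)) \<le> ereal b - ereal (- b)"
      by (intro ereal_minus_mono SUP_least INF_greatest) (simp_all only: ereal_less_eq)
  qed
  ultimately show ?thesis
    using that by (cases "oscillation f s") auto
qed

text \<open>For each \<open>e > 0\<close> some tail has supremum minus infimum below
  \<open>e\<close>, so any two of its values differ by less than \<open>e\<close>.\<close>

lemma oscillation_0_tendsto:
  fixes f :: "int \<Rightarrow> real"
  assumes "oscillation f s = 0"
  shows "\<exists>L. (f \<longlongrightarrow> L) at_top"
proof (rule int_Cauchy_tendsto)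
  fix e :: real assume "e > 0"
  then have "oscillation f s < ereal e"
    using assms by simp
  then obtain t where t: "(SUP r\<in>{t..}. ereal (f r)) - (INF r\<in>{t..}. ereal (f r)) < ereal e"
    unfolding oscillation_def by (auto simp: INF_less_iff)
  have "f u - f v < e" if "u \<ge> t" "v \<ge> t" for u v
  proof -
    have "ereal (f u) - ereal (f v) \<le> (SUP r\<in>{t..}. ereal (f r)) - (INF r\<in>{t..}. ereal (f r))"
      using that by (intro ereal_minus_mono SUP_upper INF_lower) auto
    from order_le_less_trans[OF this t] show ?thesis
      by simp
  qed
  then have "\<forall>u\<ge>t. \<forall>v\<ge>t. dist (f u) (f v) < e"
    by (auto simp: dist_real_def abs_less_iff)
  then show "\<exists>t. \<forall>u\<ge>t. \<forall>v\<ge>t. dist (f u) (f v) < e" ..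
qed

text \<open>For bounded \<open>f\<close>, an extended limit lies between 0 and the bound and is
  therefore real; without a limit, the oscillation is finite and cannot be 0. Conversely, a finite
  oscillation excludes unboundedness.\<close>

lemma bounded_iff_tendsto_or_oscillates:
  fixes f :: "int \<Rightarrow> real"
  assumes nonneg: "\<And>t. 0 \<le> f t"
  shows "bounded (f ` {s<..}) \<longleftrightarrow>
      (\<exists>L::real. L \<ge> 0 \<and> (f \<longlongrightarrow> L) at_top)
    \<or> (oscillates f \<and> (\<exists>\<Omega>::real. \<Omega> > 0 \<and> oscillation f s = ereal \<Omega>))"
    (is "?B \<longleftrightarrow> ?C \<or> ?O")
proof
  assume B: ?B
  then obtain b where b: "\<And>t. s < t \<Longrightarrow> \<bar>f t\<bar> \<le> b"
    unfolding bounded_iff by auto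
  have ev: "eventually (\<lambda>t. \<bar>f t\<bar> \<le> b) at_top"
    by (rule eventually_mono[OF eventually_gt_at_top[of s]]) (rule b)
  show "?C \<or> ?O"
  proof (cases "oscillates f")
    case True
    \<comment> \<open>\<open>oscillates\<close> excludes limits in the extended reals; real limits
      are the special case required here.\<close>
    have no_limit: "\<not> (\<exists>L. (f \<longlongrightarrow> L) at_top)"
    proof
      assume "\<exists>L. (f \<longlongrightarrow> L) at_top"
      then obtain L where "(f \<longlongrightarrow> L) at_top" ..
      then have "((\<lambda>t. ereal (f t)) \<longlongrightarrow> ereal L) at_top"
        by simp
      with True show False
        unfolding oscillates_def by blast
    qed
    obtain \<Omega> where \<Omega>: "\<Omega> \<ge> 0" "oscillation f s = ereal \<Omega>"
      using B by (rule oscillation_bounded)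
    then have "\<Omega> \<noteq> 0"
      using oscillation_0_tendsto[of f s] no_limit by (auto simp: zero_ereal_def)
    with \<Omega> True show ?thesis
      by (metis less_eq_real_def)
  next
    case False
    then obtain L where L: "((\<lambda>t. ereal (f t)) \<longlongrightarrow> L) at_top"
      unfolding oscillates_def by blast
    have "0 \<le> L"
      by (rule tendsto_lowerbound[OF L]) (simp_all add: nonneg)
    moreover have "L \<le> ereal b"
      by (rule tendsto_upperbound[OF L]) (use ev in \<open>auto elim: eventually_mono\<close>)
    ultimately obtain l where "L = ereal l" "0 \<le> l"
      by (cases L) auto
    with L show ?thesis
      by auto
  qed
next
  assume "?C \<or> ?O"
  then show ?B
  proof
    assume ?C
    then show ?B
      using int_tendsto_bounded by blast
  next
    assume ?O
    then show ?B
      using oscillation_eq_PInf[OF nonneg] by force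
  qed
qed

text \<open>The third conjunct makes "equivalently" precise for each \<open>s\<close>. Finiteness of
  \<open>\<Omega>\<close> is essential there: an unbounded sequence can also lack a limit, but its
  oscillation is then infinite.\<close>

theorem proposition7:
  fixes M :: "'a measure"
    and p q :: nat
    and \<phi>0 \<sigma>2 :: "int \<Rightarrow> real"
    and \<phi> \<theta> :: "nat \<Rightarrow> int \<Rightarrow> real"
    and y \<epsilon> :: "int \<Rightarrow> 'a \<Rightarrow> real"
  defines "F \<equiv> \<lambda>t s. F_sum p \<phi> t s"
    and "mse \<equiv> \<lambda>t s. MSE M p q \<phi> \<theta> \<epsilon> t s"
  assumes "tv_arma M p q \<phi>0 \<phi> \<theta> \<sigma>2 y \<epsilon>"
    and "\<And>t. (\<lambda>r. \<bar>xi p \<phi> t r\<bar>) summable_on {..t}"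
    and "bounded (range \<phi>0)"
    and "\<And>l. l \<in> {1..q} \<Longrightarrow> bounded (range (\<theta> l))"
  shows "(\<forall>s t. s < t \<longrightarrow> mse t s = (\<Sum>r=s+1..t. (xi_q p q \<phi> \<theta> t r)\<^sup>2 * \<sigma>2 r))
    \<and> ((\<forall>s. bounded ((\<lambda>t. F t s) ` {s<..})) \<longrightarrow> (\<forall>s. bounded ((\<lambda>t. mse t s) ` {s<..})))
    \<and> (\<forall>s. bounded ((\<lambda>t. mse t s) ` {s<..}) \<longleftrightarrow>
          (\<exists>L::real. L \<ge> 0 \<and> ((\<lambda>t. mse t s) \<longlongrightarrow> L) at_top)
        \<or> (oscillates (\<lambda>t. mse t s)
            \<and> (\<exists>\<Omega>::real. \<Omega> > 0 \<and> oscillation (\<lambda>t. mse t s) s = ereal \<Omega>)))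
    \<and> ((\<forall>s. bounded ((\<lambda>t. F t s) ` {s<..})) \<longrightarrow>
        (\<forall>s. (\<exists>L::real. L \<ge> 0 \<and> ((\<lambda>t. mse t s) \<longlongrightarrow> L) at_top)
           \<or> (oscillates (\<lambda>t. mse t s)
               \<and> (\<exists>\<Omega>::real. \<Omega> > 0 \<and> oscillation (\<lambda>t. mse t s) s = ereal \<Omega>))))"
proof -
  interpret tv_arma M p q \<phi>0 \<phi> \<theta> \<sigma>2 y \<epsilon>
    by fact
  \<comment> \<open>As a variance, the MSE is nonnegative at all times, including
    \<open>t \<le> s\<close>, which is the form the equivalence asks for.\<close>
  have "0 \<le> mse t s" for t s
    unfolding mse_def MSE_def by (rule variance_positive)
  then have equiv: "bounded ((\<lambda>t. mse t s) ` {s<..}) \<longleftrightarrow>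
        (\<exists>L::real. L \<ge> 0 \<and> ((\<lambda>t. mse t s) \<longlongrightarrow> L) at_top)
      \<or> (oscillates (\<lambda>t. mse t s)
          \<and> (\<exists>\<Omega>::real. \<Omega> > 0 \<and> oscillation (\<lambda>t. mse t s) s = ereal \<Omega>))" for s
    by (rule bounded_iff_tendsto_or_oscillates)
  have bdd: "bounded ((\<lambda>t. mse t s) ` {s<..})" if "bounded ((\<lambda>t. F t s) ` {s<..})" for s
    using MSE_bounded assms(6) that unfolding mse_def F_def by blast
  have "mse t s = (\<Sum>r=s+1..t. (xi_q p q \<phi> \<theta> t r)\<^sup>2 * \<sigma>2 r)" for s t
    unfolding mse_def by (rule MSE_eq)
  with bdd equiv show ?thesis
    by simp
qed

end
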